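(* Consider the two-stage GOPA model with $I$ experts, $J$ attributes, expert ranks $t_i$, attribute ranks $s_{ij}$, and no missing or duplicate rankings of the alternatives (all $c_{ijr}=1$). Let $\Gamma$ denote the set of all possible global utility structures, discrete or continuous. Then the optimal objective value $z^*$ of the second-stage problem is invariant over $\Gamma$: for any two assignments of global utility structures to the pairs $(i,j)$ for which the first-stage problems have optimal solutions, the corresponding second-stage optimal values $z^*$ coincide.
   Context: $[n]=\{1,\dots,n\}$; $0\ln0=0$. Let $i\in[I]$ index experts and $j\in[J]$ attributes; $t_i,s_{ij}$ are fixed positive integers; $K_{ij}$ is the number of ranks used for alternatives under $(i,j)$ (equal to the number $K$ of alternatives when there are no missing or duplicate rankings); $\mathcal U=\{(i,j,r):i\in[I],j\in[J],r\in[K_{ij}]\}$. First stage. To each pair $(i,j)$ is assigned a global utility structure, which is either discrete, i.e. a positive target vector $V(r)$, $r\in[K_{ij}]$, or continuous, i.e. a positive integrable target density $v$ on $(0,K_{ij}]$. Discrete case: $U^*_{ij}$ minimizes $\sum_{r=1}^{K_{ij}}U(r)\ln\frac{U(r)}{V(r)}$ over vectors $U\in\mathbb R^{K_{ij}}$ with $U(r)\ge0$, $\sum_rU(r)=1$, $U(r)\ge U(r+1)$ for $r\in[K_{ij}-1]$, and finitely many given constraints of the forms $U(r)=\alpha U(r+1)$, $U(r)-U(r+1)=\beta$, $U(r)\ge\gamma$. Put $U^*_{ijr}=U^*_{ij}(r)$. Continuous case: $u^*_{ij}$ minimizes $\int_0^{K_{ij}}u\ln(u/v)\,dx$ over integrable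 $u\ge0$ on $[0,K_{ij}]$ with $\int_0^{K_{ij}}u\,dx=1$ and finitely many given constraints of the forms $\int_0^ru\,dx=\alpha\int_0^{r-1}u\,dx$, $\int_0^ru\,dx-\int_0^{r-1}u\,dx=\beta$, $\int_0^ru\,dx=\gamma$. Put $U^*_{ijr}=\int_0^ru^*_{ij}(K_{ij}-x)\,dx\Big/\sum_{r'=1}^{K_{ij}}\int_0^{r'}u^*_{ij}(K_{ij}-x)\,dx$. Second stage. With $c_{ijr}$ the number of alternatives given rank $r$ by expert $i$ under attribute $j$: $$\max_{\mathbf w,z}z\ \text{ s.t. }K_{ij}U^*_{ijr}z\le t_is_{ij}w_{ijr}\ \forall(i,j,r)\in\mathcal U,\quad\sum_{(i,j,r)\in\mathcal U}c_{ijr}w_{ijr}=1,\quad w_{ijr}\ge0.$$ *)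

theory Defs
  imports "HOL-Analysis.Analysis"
begin

text \<open>
  Experts, attributes, alternatives and ranks are numbered from 1. A ranking of the
  alternatives \<open>1, \<dots>, K\<close> maps each of them to its rank, or to \<^const>\<open>None\<close> if the
  ranking is missing; alternatives with duplicate rankings share a rank.
\<close>

type_synonym ranking = "nat \<Rightarrow> nat option"

definition ranks_used :: "nat \<Rightarrow> ranking \<Rightarrow> nat set" where
  "ranks_used K \<rho> = {r. \<exists>k\<in>{1..K}. \<rho> k = Some r}"

definition num_ranks :: "nat \<Rightarrow> ranking \<Rightarrow> nat" where
  "num_ranks K \<rho> = card (ranks_used K \<rho>)"

definition rank_count :: "nat \<Rightarrow> ranking \<Rightarrow> nat \<Rightarrow> nat" where
  "rank_count K \<rho> r = card {k\<in>{1..K}. \<rho> k = Some r}"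

definition valid_ranking :: "nat \<Rightarrow> ranking \<Rightarrow> bool" where
  "valid_ranking K \<rho> \<longleftrightarrow> ranks_used K \<rho> = {1..num_ranks K \<rho>}"

definition no_missing_rankings :: "nat \<Rightarrow> ranking \<Rightarrow> bool" where
  "no_missing_rankings K \<rho> \<longleftrightarrow> (\<forall>k\<in>{1..K}. \<rho> k \<noteq> None)"

definition no_duplicate_rankings :: "nat \<Rightarrow> ranking \<Rightarrow> bool" where
  "no_duplicate_rankings K \<rho> \<longleftrightarrow>
     (\<forall>k\<in>{1..K}. \<forall>l\<in>{1..K}. \<rho> k \<noteq> None \<and> \<rho> k = \<rho> l \<longrightarrow> k = l)"

lemma num_ranks_eq:
  assumes "no_missing_rankings K \<rho>" "no_duplicate_rankings K \<rho>"
  shows "num_ranks K \<rho> = K"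
proof -
  have "ranks_used K \<rho> = (the \<circ> \<rho>) ` {1..K}"
    using assms(1) by (force simp: ranks_used_def no_missing_rankings_def)
  moreover have "inj_on (the \<circ> \<rho>) {1..K}"
    using assms unfolding no_missing_rankings_def no_duplicate_rankings_def inj_on_def
    by (metis comp_apply option.expand)
  then have "card ((the \<circ> \<rho>) ` {1..K}) = card {1..K}"
    by (rule card_image)
  ultimately show ?thesis
    by (simp add: num_ranks_def)
qed

lemma rank_count_eq:
  assumes "valid_ranking K \<rho>" "no_duplicate_rankings K \<rho>" "r \<in> {1..num_ranks K \<rho>}"
  shows "rank_count K \<rho> r = 1"
proof -
  from assms(1,3) obtain k where k: "k \<in> {1..K}" "\<rho> k = Some r"
    unfolding valid_ranking_def ranks_used_def by blast
  have "{l\<in>{1..K}. \<rho> l = Some r} = {k}"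
    using k assms(2) unfolding no_duplicate_rankings_def by fastforce
  then show ?thesis
    by (simp add: rank_count_def)
qed

text \<open>
  The three kinds of side conditions are read differently for discrete and for continuous
  structures; see \<open>discrete_constraint\<close> and \<open>continuous_constraint\<close>.
\<close>

datatype utility_constraint = Ratio nat real | Diff nat real | Bound nat real

datatype utility_structure =
    Discrete "nat \<Rightarrow> real" "utility_constraint set"
  | Continuous "real \<Rightarrow> real" "utility_constraint set"

text \<open>
  A vector indexed by \<open>1, \<dots>, n\<close> is represented by a function on \<^typ>\<open>nat\<close>, and a function on
  \<open>[0, n]\<close> by a function on \<^typ>\<open>real\<close>; the values elsewhere are irrelevant.
\<close>

fun discrete_constraint_index :: "nat \<Rightarrow> utility_constraint \<Rightarrow> bool" where
  "discrete_constraint_index n (Ratio r a) \<longleftrightarrow> 1 \<le> r \<and> r < n"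
| "discrete_constraint_index n (Diff r b) \<longleftrightarrow> 1 \<le> r \<and> r < n"
| "discrete_constraint_index n (Bound r g) \<longleftrightarrow> 1 \<le> r \<and> r \<le> n"

fun continuous_constraint_index :: "nat \<Rightarrow> utility_constraint \<Rightarrow> bool" where
  "continuous_constraint_index n (Ratio r a) \<longleftrightarrow> 1 \<le> r \<and> r \<le> n"
| "continuous_constraint_index n (Diff r b) \<longleftrightarrow> 1 \<le> r \<and> r \<le> n"
| "continuous_constraint_index n (Bound r g) \<longleftrightarrow> 1 \<le> r \<and> r \<le> n"

fun global_utility_structure :: "nat \<Rightarrow> utility_structure \<Rightarrow> bool" where
  "global_utility_structure n (Discrete V C) \<longleftrightarrow>
     (\<forall>r\<in>{1..n}. 0 < V r) \<and> finite C \<and> (\<forall>c\<in>C. discrete_constraint_index n c)"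
| "global_utility_structure n (Continuous v C) \<longleftrightarrow>
     (\<forall>x\<in>{0<..real n}. 0 < v x) \<and> set_integrable lebesgue {0<..real n} v \<and>
     finite C \<and> (\<forall>c\<in>C. continuous_constraint_index n c)"

fun discrete_constraint :: "(nat \<Rightarrow> real) \<Rightarrow> utility_constraint \<Rightarrow> bool" where
  "discrete_constraint U (Ratio r a) \<longleftrightarrow> U r = a * U (r + 1)"
| "discrete_constraint U (Diff r b) \<longleftrightarrow> U r - U (r + 1) = b"
| "discrete_constraint U (Bound r g) \<longleftrightarrow> U r \<ge> g"

definition discrete_feasible :: "nat \<Rightarrow> utility_constraint set \<Rightarrow> (nat \<Rightarrow> real) \<Rightarrow> bool" where
  "discrete_feasible n C U \<longleftrightarrow>
     (\<forall>r\<in>{1..n}. 0 \<le> U r) \<and> (\<Sum>r=1..n. U r) = 1 \<and>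
     (\<forall>r\<in>{1..<n}. U (r + 1) \<le> U r) \<and> (\<forall>c\<in>C. discrete_constraint U c)"

text \<open>Since \<^term>\<open>ln (0::real)\<close> is 0, a component \<open>U r = 0\<close> contributes 0.\<close>

definition discrete_entropy :: "nat \<Rightarrow> (nat \<Rightarrow> real) \<Rightarrow> (nat \<Rightarrow> real) \<Rightarrow> real" where
  "discrete_entropy n V U = (\<Sum>r=1..n. U r * ln (U r / V r))"

fun continuous_constraint :: "(real \<Rightarrow> real) \<Rightarrow> utility_constraint \<Rightarrow> bool" where
  "continuous_constraint u (Ratio r a) \<longleftrightarrow>
     (LINT x:{0..real r}|lebesgue. u x) = a * (LINT x:{0..real r - 1}|lebesgue. u x)"
| "continuous_constraint u (Diff r b) \<longleftrightarrow>
     (LINT x:{0..real r}|lebesgue. u x) - (LINT x:{0..real r - 1}|lebesgue. u x) = b"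
| "continuous_constraint u (Bound r g) \<longleftrightarrow>
     (LINT x:{0..real r}|lebesgue. u x) = g"

definition continuous_feasible :: "nat \<Rightarrow> utility_constraint set \<Rightarrow> (real \<Rightarrow> real) \<Rightarrow> bool" where
  "continuous_feasible n C u \<longleftrightarrow>
     (\<forall>x\<in>{0..real n}. 0 \<le> u x) \<and> set_integrable lebesgue {0..real n} u \<and>
     (LINT x:{0..real n}|lebesgue. u x) = 1 \<and> (\<forall>c\<in>C. continuous_constraint u c)"

text \<open>
  The integral of \<open>u ln (u / v)\<close> may be \<open>\<infinity>\<close>, so it is taken as the extended-real difference of
  the integrals of the positive and negative parts of the integrand. The negative part is
  bounded by \<open>v / e\<close> and thus has a finite integral. (The Bochner integral would be 0 for a
  non-integrable integrand.)
\<close>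

definition continuous_entropy :: "nat \<Rightarrow> (real \<Rightarrow> real) \<Rightarrow> (real \<Rightarrow> real) \<Rightarrow> ereal" where
  "continuous_entropy n v u =
     enn2ereal (\<integral>\<^sup>+x\<in>{0<..real n}. ennreal (u x * ln (u x / v x)) \<partial>lebesgue) -
     enn2ereal (\<integral>\<^sup>+x\<in>{0<..real n}. ennreal (- (u x * ln (u x / v x))) \<partial>lebesgue)"

definition discretized_utility :: "nat \<Rightarrow> (real \<Rightarrow> real) \<Rightarrow> nat \<Rightarrow> real" where
  "discretized_utility n u r =
     (LINT x:{0..real r}|lebesgue. u (real n - x)) /
     (\<Sum>r'=1..n. LINT x:{0..real r'}|lebesgue. u (real n - x))"

fun first_stage_utilities :: "nat \<Rightarrow> utility_structure \<Rightarrow> (nat \<Rightarrow> real) \<Rightarrow> bool" where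
  "first_stage_utilities n (Discrete V C) U \<longleftrightarrow>
     is_arg_min (discrete_entropy n V) (discrete_feasible n C) U"
| "first_stage_utilities n (Continuous v C) U \<longleftrightarrow>
     (\<exists>u. is_arg_min (continuous_entropy n v) (continuous_feasible n C) u \<and>
          (\<forall>r\<in>{1..n}. U r = discretized_utility n u r))"

text \<open>
  Here \<open>n i j\<close> is the number of ranks used by expert \<open>i\<close> under attribute \<open>j\<close>, and \<open>c i j r\<close> is
  the number of alternatives given rank \<open>r\<close>.
\<close>

definition index_set :: "nat \<Rightarrow> nat \<Rightarrow> (nat \<Rightarrow> nat \<Rightarrow> nat) \<Rightarrow> (nat \<times> nat \<times> nat) set" where
  "index_set I J n = {(i, j, r). i \<in> {1..I} \<and> j \<in> {1..J} \<and> r \<in> {1..n i j}}"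

definition second_stage_feasible ::
  "nat \<Rightarrow> nat \<Rightarrow> (nat \<Rightarrow> nat \<Rightarrow> nat) \<Rightarrow> (nat \<Rightarrow> nat \<Rightarrow> nat \<Rightarrow> nat) \<Rightarrow>
   (nat \<Rightarrow> nat) \<Rightarrow> (nat \<Rightarrow> nat \<Rightarrow> nat) \<Rightarrow> (nat \<Rightarrow> nat \<Rightarrow> nat \<Rightarrow> real) \<Rightarrow>
   (nat \<Rightarrow> nat \<Rightarrow> nat \<Rightarrow> real) \<Rightarrow> real \<Rightarrow> bool" where
  "second_stage_feasible I J n c t s U w z \<longleftrightarrow>
     (\<forall>(i, j, r)\<in>index_set I J n.
        real (n i j) * U i j r * z \<le> real (t i) * real (s i j) * w i j r) \<and>
     (\<Sum>(i, j, r)\<in>index_set I J n. real (c i j r) * w i j r) = 1 \<and>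
     (\<forall>(i, j, r)\<in>index_set I J n. 0 \<le> w i j r)"

definition second_stage_optimal_value ::
  "nat \<Rightarrow> nat \<Rightarrow> (nat \<Rightarrow> nat \<Rightarrow> nat) \<Rightarrow> (nat \<Rightarrow> nat \<Rightarrow> nat \<Rightarrow> nat) \<Rightarrow>
   (nat \<Rightarrow> nat) \<Rightarrow> (nat \<Rightarrow> nat \<Rightarrow> nat) \<Rightarrow> (nat \<Rightarrow> nat \<Rightarrow> nat \<Rightarrow> real) \<Rightarrow> real \<Rightarrow> bool" where
  "second_stage_optimal_value I J n c t s U z \<longleftrightarrow>
     (\<exists>w. is_arg_max snd (\<lambda>(w, z). second_stage_feasible I J n c t s U w z) (w, z))"

definition gopa_optimal_value ::
  "nat \<Rightarrow> nat \<Rightarrow> nat \<Rightarrow> (nat \<Rightarrow> nat \<Rightarrow> ranking) \<Rightarrow>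
   (nat \<Rightarrow> nat) \<Rightarrow> (nat \<Rightarrow> nat \<Rightarrow> nat) \<Rightarrow> (nat \<Rightarrow> nat \<Rightarrow> nat \<Rightarrow> real) \<Rightarrow> real \<Rightarrow> bool" where
  "gopa_optimal_value I J K \<rho> t s U z \<longleftrightarrow>
     second_stage_optimal_value I J
       (\<lambda>i j. num_ranks K (\<rho> i j)) (\<lambda>i j r. rank_count K (\<rho> i j) r) t s U z"

end

theory Submission
  imports Defs
begin

text \<open>
  Whatever its structure, a first-stage solution is a probability vector. In the second stage the
  constraints bound the weights below, and summing these bounds over all ranks replaces the
  utilities of each pair by their total 1. Hence \<open>z\<close> is at most
  \<open>1 / (\<Sum>i j. K / (t\<^sub>i s\<^sub>i\<^sub>j))\<close>, and equality throughout is feasible.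
\<close>

text \<open>The map \<open>x \<mapsto> a - x\<close> is affine with factor -1, so Lebesgue measure
  is its own image under it up to the constant density \<open>\<bar>- 1\<bar>\<close>, which is
  1.\<close>

lemma lebesgue_integral_reflect:
  fixes f :: "real \<Rightarrow> real"
  assumes "f \<in> borel_measurable lebesgue"
  shows "(LINT x|lebesgue. f (a - x)) = (LINT x|lebesgue. f x)"
proof -
  have leb: "lebesgue = density (distr lebesgue lebesgue (\<lambda>x. a + (- 1) * x)) (\<lambda>_. ennreal \<bar>- 1\<bar>)"
    by (rule lebesgue_real_affine) simp
  have meas: "(\<lambda>x::real. a - x) \<in> lebesgue \<rightarrow>\<^sub>M lebesgue"
    using lebesgue_affine_measurable[where c = "\<lambda>_::real. - 1" and t = a] by simp
  from leb have "lebesgue = distr lebesgue lebesgue (\<lambda>x. a - x)"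
    by (simp add: density_1)
  then have "(LINT x|lebesgue. f x) = (LINT x|distr lebesgue lebesgue (\<lambda>x. a - x). f x)"
    by (rule arg_cong)
  also have "\<dots> = (LINT x|lebesgue. f (a - x))"
    by (rule integral_distr[OF meas assms])
  finally show ?thesis ..
qed

text \<open>Extend \<open>u\<close> by zero outside \<open>{0..a}\<close> and reflect on the whole
  line: the interval is mapped onto itself, so its indicator does not change.\<close>

lemma set_lebesgue_integral_reflect:
  fixes u :: "real \<Rightarrow> real"
  assumes "set_integrable lebesgue {0..a} u"
  shows "(LINT x:{0..a}|lebesgue. u (a - x)) = (LINT x:{0..a}|lebesgue. u x)"
proof -
  have "(\<lambda>x. indicator {0..a} x *\<^sub>R u x) \<in> borel_measurable lebesgue"
    using assms unfolding set_integrable_def by (rule borel_measurable_integrable)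
  from lebesgue_integral_reflect[OF this, of a]
  show ?thesis
    by (simp add: set_lebesgue_integral_def indicator_def conj_commute)
qed

text \<open>The interface between the stages: discrete and continuous solutions enter the second
  stage through this common property.\<close>

definition probability_vector :: "nat \<Rightarrow> (nat \<Rightarrow> real) \<Rightarrow> bool" where
  "probability_vector n U \<longleftrightarrow> (\<forall>r\<in>{1..n}. 0 \<le> U r) \<and> (\<Sum>r=1..n. U r) = 1"

text \<open>The entries are normalized by their sum, so the point is that this sum is not 0. Its
  last term is the total mass of the reflected \<open>u\<close>, which is 1, and the other terms are
  nonnegative.\<close>

lemma probability_vector_discretized_utility:
  assumes "1 \<le> n" and "continuous_feasible n C u"
  shows "probability_vector n (discretized_utility n u)"
proof -
  define g where "g r = (LINT x:{0..real r}|lebesgue. u (real n - x))" for r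
  \<comment> \<open>For \<open>x\<close> in \<open>{0..r}\<close> and \<open>r \<le> n\<close> the
    argument \<open>n - x\<close> stays in \<open>{0..n}\<close>, where feasibility makes
    \<open>u\<close> nonnegative.\<close>
  have nonneg: "0 \<le> g r" if "r \<in> {1..n}" for r
    using assms(2) that unfolding g_def set_lebesgue_integral_def
    by (intro integral_nonneg_AE AE_I2) (auto simp: continuous_feasible_def indicator_def)
  have "g n = 1"
    using assms(2) by (simp add: g_def continuous_feasible_def set_lebesgue_integral_reflect)
  moreover have "g n \<le> (\<Sum>r=1..n. g r)"
    using assms(1) nonneg by (intro member_le_sum) auto
  ultimately have pos: "0 < (\<Sum>r=1..n. g r)"
    by simp
  have "discretized_utility n u r = g r / (\<Sum>r=1..n. g r)" for r
    by (simp add: discretized_utility_def g_def)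
  then show ?thesis
    using pos nonneg by (auto simp: probability_vector_def simp flip: sum_divide_distrib)
qed

lemma probability_vector_first_stage:
  assumes "1 \<le> n" and "first_stage_utilities n S U"
  shows "probability_vector n U"
proof (cases S)
  case (Discrete V C)
  with assms(2) show ?thesis
    by (simp add: is_arg_min_def discrete_feasible_def probability_vector_def)
next
  case (Continuous v C)
  with assms(2) obtain u where "continuous_feasible n C u"
    and "\<forall>r\<in>{1..n}. U r = discretized_utility n u r"
    by (auto simp: is_arg_min_def)
  with probability_vector_discretized_utility[OF assms(1)] show ?thesis
    by (simp add: probability_vector_def)
qed

lemma index_set_Sigma:
  "index_set I J n = (SIGMA i:{1..I}. SIGMA j:{1..J}. {1..n i j})"
  by (auto simp: index_set_def)

lemma sum_index_set:
  "(\<Sum>(i, j, r)\<in>index_set I J n. f i j r) = (\<Sum>i=1..I. \<Sum>j=1..J. \<Sum>r=1..n i j. f i j r)"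
  by (simp add: index_set_Sigma sum.Sigma)

text \<open>The equivalence packs together that an optimum exists and that its value is unique. The
  right-hand side does not mention \<open>U\<close>.\<close>

lemma second_stage_optimal_value_iff:
  assumes "1 \<le> I" and "1 \<le> J"
    and t: "\<And>i. i \<in> {1..I} \<Longrightarrow> 0 < t i"
    and s: "\<And>i j. i \<in> {1..I} \<Longrightarrow> j \<in> {1..J} \<Longrightarrow> 0 < s i j"
    and n: "\<And>i j. i \<in> {1..I} \<Longrightarrow> j \<in> {1..J} \<Longrightarrow> 1 \<le> n i j"
    and c: "\<And>i j r. (i, j, r) \<in> index_set I J n \<Longrightarrow> c i j r = 1"
    and U: "\<And>i j. i \<in> {1..I} \<Longrightarrow> j \<in> {1..J} \<Longrightarrow> probability_vector (n i j) (U i j)"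
  shows "second_stage_optimal_value I J n c t s U z \<longleftrightarrow>
    z = 1 / (\<Sum>i=1..I. \<Sum>j=1..J. real (n i j) / (real (t i) * real (s i j)))"
proof -
  \<comment> \<open>Solving the constraint of the linear program for the weight turns it into
    \<open>w i j r \<ge> a i j * U i j r * z\<close>.\<close>
  define a where "a i j = real (n i j) / (real (t i) * real (s i j))" for i j
  define S where "S = (\<Sum>i=1..I. \<Sum>j=1..J. a i j)"
  have a_pos: "0 < a i j" if "i \<in> {1..I}" "j \<in> {1..J}" for i j
    using t[OF that(1)] s[OF that] n[OF that] by (simp add: a_def)
  have S_pos: "0 < S"
    unfolding S_def using assms(1,2) a_pos by (intro sum_pos) auto
  \<comment> \<open>For each pair the sum over \<open>r\<close> collapses because
    \<open>U i j\<close> sums to 1. This is used twice: for the upper bound, and to see that the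
    witness has total weight 1.\<close>
  have sum_aU: "(\<Sum>(i, j, r)\<in>index_set I J n. a i j * U i j r * y) = S * y" for y
    unfolding sum_index_set S_def sum_distrib_right
    using U by (intro sum.cong refl)
      (simp add: probability_vector_def flip: sum_distrib_left sum_distrib_right)
  have sum_c: "(\<Sum>(i, j, r)\<in>index_set I J n. real (c i j r) * w i j r) =
      (\<Sum>(i, j, r)\<in>index_set I J n. w i j r)" for w
    by (intro sum.cong refl) (auto simp: c)
  have constraint: "real (n i j) * U i j r * y \<le> real (t i) * real (s i j) * w i j r \<longleftrightarrow>
      a i j * U i j r * y \<le> w i j r" if "(i, j, r) \<in> index_set I J n" for i j r y w
  proof -
    have "0 < real (t i) * real (s i j)"
      using that t s by (auto simp: index_set_def)
    then show ?thesis
      by (simp add: a_def pos_divide_le_eq mult.commute)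
  qed
  have feasible: "second_stage_feasible I J n c t s U w y \<longleftrightarrow>
      (\<forall>(i, j, r)\<in>index_set I J n. a i j * U i j r * y \<le> w i j r) \<and>
      (\<Sum>(i, j, r)\<in>index_set I J n. w i j r) = 1 \<and>
      (\<forall>(i, j, r)\<in>index_set I J n. 0 \<le> w i j r)" for w y
    unfolding second_stage_feasible_def sum_c using constraint by fast
  \<comment> \<open>Adding up all lower bounds on the weights gives \<open>S * y \<le> 1\<close>,
    whatever the sign of \<open>y\<close>.\<close>
  have bound: "y \<le> 1 / S" if "second_stage_feasible I J n c t s U w y" for w y
  proof -
    have "S * y \<le> (\<Sum>(i, j, r)\<in>index_set I J n. w i j r)"
      unfolding sum_aU[symmetric] using that by (intro sum_mono) (auto simp: feasible)
    also have "\<dots> = 1"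
      using that by (simp add: feasible)
    finally show ?thesis
      using S_pos by (simp add: pos_le_divide_eq mult.commute)
  qed
  \<comment> \<open>The witness makes every constraint tight; the factor \<open>1 / S\<close> scales
    the total weight to 1.\<close>
  have attained: "second_stage_feasible I J n c t s U (\<lambda>i j r. a i j * U i j r * (1 / S)) (1 / S)"
    unfolding feasible sum_aU using S_pos a_pos U
    by (auto simp: index_set_def probability_vector_def less_imp_le)
  have "second_stage_optimal_value I J n c t s U z \<longleftrightarrow> z = 1 / S"
  proof
    assume "second_stage_optimal_value I J n c t s U z"
    then obtain w where "second_stage_feasible I J n c t s U w z"
      and "\<not> z < 1 / S"
      using attained unfolding second_stage_optimal_value_def is_arg_max_def by auto
    with bound show "z = 1 / S"
      by force
  next
    assume "z = 1 / S"
    with attained bound show "second_stage_optimal_value I J n c t s U z"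
      unfolding second_stage_optimal_value_def is_arg_max_def by (fastforce simp: not_less)
  qed
  then show ?thesis
    by (simp add: S_def a_def)
qed

text \<open>Complete rankings without ties use exactly \<open>K \<ge> 1\<close> ranks, each once,
  which supplies the numerical hypotheses on \<open>n\<close> and \<open>c\<close> of the previous
  lemma.\<close>

lemma gopa_optimal_value_iff:
  assumes "1 \<le> I" and "1 \<le> J" and "1 \<le> K"
    and "\<And>i. i \<in> {1..I} \<Longrightarrow> 0 < t i"
    and "\<And>i j. i \<in> {1..I} \<Longrightarrow> j \<in> {1..J} \<Longrightarrow> 0 < s i j"
    and valid: "\<And>i j. i \<in> {1..I} \<Longrightarrow> j \<in> {1..J} \<Longrightarrow> valid_ranking K (\<rho> i j)"
    and no_missing: "\<And>i j. i \<in> {1..I} \<Longrightarrow> j \<in> {1..J} \<Longrightarrow> no_missing_rankings K (\<rho> i j)"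
    and no_dup: "\<And>i j. i \<in> {1..I} \<Longrightarrow> j \<in> {1..J} \<Longrightarrow> no_duplicate_rankings K (\<rho> i j)"
    and first: "\<And>i j. i \<in> {1..I} \<Longrightarrow> j \<in> {1..J} \<Longrightarrow>
           first_stage_utilities (num_ranks K (\<rho> i j)) (G i j) (U i j)"
  shows "gopa_optimal_value I J K \<rho> t s U z \<longleftrightarrow>
    z = 1 / (\<Sum>i=1..I. \<Sum>j=1..J. real (num_ranks K (\<rho> i j)) / (real (t i) * real (s i j)))"
  unfolding gopa_optimal_value_def
proof (rule second_stage_optimal_value_iff)
  fix i j assume ij: "i \<in> {1..I}" "j \<in> {1..J}"
  show ranks: "1 \<le> num_ranks K (\<rho> i j)"
    using num_ranks_eq[OF no_missing[OF ij] no_dup[OF ij]] assms(3) by simp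
  show "probability_vector (num_ranks K (\<rho> i j)) (U i j)"
    by (rule probability_vector_first_stage[OF ranks first[OF ij]])
next
  fix i j r assume "(i, j, r) \<in> index_set I J (\<lambda>i j. num_ranks K (\<rho> i j))"
  then show "rank_count K (\<rho> i j) r = 1"
    using valid no_dup by (intro rank_count_eq) (auto simp: index_set_def)
qed (use assms in auto)

theorem corollary4:
  fixes I J K :: nat
    and t :: "nat \<Rightarrow> nat" and s :: "nat \<Rightarrow> nat \<Rightarrow> nat"
    and \<rho> :: "nat \<Rightarrow> nat \<Rightarrow> ranking"
    and G1 G2 :: "nat \<Rightarrow> nat \<Rightarrow> utility_structure"
    and U1 U2 :: "nat \<Rightarrow> nat \<Rightarrow> nat \<Rightarrow> real"
  assumes "1 \<le> I" and "1 \<le> J" and "1 \<le> K"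
    and "\<And>i. i \<in> {1..I} \<Longrightarrow> 0 < t i"
    and "\<And>i j. i \<in> {1..I} \<Longrightarrow> j \<in> {1..J} \<Longrightarrow> 0 < s i j"
    and "\<And>i j. i \<in> {1..I} \<Longrightarrow> j \<in> {1..J} \<Longrightarrow> valid_ranking K (\<rho> i j)"
    and "\<And>i j. i \<in> {1..I} \<Longrightarrow> j \<in> {1..J} \<Longrightarrow> no_missing_rankings K (\<rho> i j)"
    and "\<And>i j. i \<in> {1..I} \<Longrightarrow> j \<in> {1..J} \<Longrightarrow> no_duplicate_rankings K (\<rho> i j)"
    and "\<And>i j. i \<in> {1..I} \<Longrightarrow> j \<in> {1..J} \<Longrightarrow>
           global_utility_structure (num_ranks K (\<rho> i j)) (G1 i j)"
    and "\<And>i j. i \<in> {1..I} \<Longrightarrow> j \<in> {1..J} \<Longrightarrow>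
           global_utility_structure (num_ranks K (\<rho> i j)) (G2 i j)"
    and "\<And>i j. i \<in> {1..I} \<Longrightarrow> j \<in> {1..J} \<Longrightarrow>
           first_stage_utilities (num_ranks K (\<rho> i j)) (G1 i j) (U1 i j)"
    and "\<And>i j. i \<in> {1..I} \<Longrightarrow> j \<in> {1..J} \<Longrightarrow>
           first_stage_utilities (num_ranks K (\<rho> i j)) (G2 i j) (U2 i j)"
  shows "\<exists>zopt. (\<forall>z. gopa_optimal_value I J K \<rho> t s U1 z \<longleftrightarrow> z = zopt) \<and>
                (\<forall>z. gopa_optimal_value I J K \<rho> t s U2 z \<longleftrightarrow> z = zopt)"
\<comment> \<open>The existential witness stays schematic until the first \<open>show\<close> sets
  it to \<open>?z\<close>, a term free of \<open>U1\<close> and \<open>U2\<close> that therefore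
  serves both assignments.\<close>
proof (intro exI conjI allI)
  fix z
  let ?z = "1 / (\<Sum>i=1..I. \<Sum>j=1..J. real (num_ranks K (\<rho> i j)) / (real (t i) * real (s i j)))"
  show "gopa_optimal_value I J K \<rho> t s U1 z \<longleftrightarrow> z = ?z"
    by (rule gopa_optimal_value_iff[where G = G1]) (use assms in auto)
  show "gopa_optimal_value I J K \<rho> t s U2 z \<longleftrightarrow> z = ?z"
    by (rule gopa_optimal_value_iff[where G = G2]) (use assms in auto)
qed

end
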